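(* Any $G_{\delta\sigma}$ ideal $\mathcal J$ on $\omega$ is extendable to an $F_\sigma$ ideal, i.e. there is an $F_\sigma$ ideal $\mathcal J'$ on $\omega$ with $\mathcal J\subseteq\mathcal J'$.
   Context: An ideal on $\omega$ is a family of subsets of $\omega$ closed under finite unions and subsets, containing all finite sets and not containing $\omega$. $F_\sigma$ and $G_{\delta\sigma}$ (countable unions of $G_\delta$ sets) refer to subsets of $\mathcal P(\omega)$ with the Cantor space topology, identifying sets with characteristic functions in $\{0,1\}^\omega$. *)

theory Defs
  imports "HOL-Analysis.Analysis"
begin

definition omega_ideal :: "nat set set \<Rightarrow> bool" where
  "omega_ideal J \<longleftrightarrow>
     (\<forall>A\<in>J. \<forall>B\<in>J. A \<union> B \<in> J) \<and>
     (\<forall>A\<in>J. \<forall>B. B \<subseteq> A \<longrightarrow> B \<in> J) \<and>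
     (\<forall>A. finite A \<longrightarrow> A \<in> J) \<and>
     UNIV \<notin> J"

definition cantor_topology :: "(nat \<Rightarrow> bool) topology" where
  "cantor_topology = product_topology (\<lambda>_. discrete_topology UNIV) UNIV"

(* The topology on the power set of omega that makes the bijection sending a
   set to its characteristic function a homeomorphism onto the Cantor space. *)
definition powerset_topology :: "nat set topology" where
  "powerset_topology = pullback_topology UNIV (\<lambda>A n. n \<in> A) cantor_topology"

definition gdelta_sigma_in :: "'a topology \<Rightarrow> 'a set \<Rightarrow> bool" where
  "gdelta_sigma_in X = countable union_of gdelta_in X"

lemma topspace_cantor_topology [simp]: "topspace cantor_topology = UNIV"
  by (simp add: cantor_topology_def)

lemma topspace_powerset_topology [simp]: "topspace powerset_topology = UNIV"
  by (simp add: powerset_topology_def topspace_pullback_topology)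

lemma homeomorphic_map_characteristic_function:
  "homeomorphic_map powerset_topology cantor_topology (\<lambda>A n. n \<in> A)"
proof -
  have bij: "bij (\<lambda>(A::nat set) n. n \<in> A)"
    by (rule bij_betw_byWitness[where f' = Collect]) auto
  have op: "openin powerset_topology (U :: nat set set)
      \<longleftrightarrow> openin cantor_topology ((\<lambda>A n. n \<in> A) ` U)" for U
  proof
    assume "openin powerset_topology U"
    then obtain V where V: "openin cantor_topology V" "U = (\<lambda>A n. n \<in> A) -` V"
      by (auto simp: powerset_topology_def openin_pullback_topology)
    then show "openin cantor_topology ((\<lambda>A n. n \<in> A) ` U)"
      using bij by (simp add: bij_is_surj surj_image_vimage_eq)
  next
    assume "openin cantor_topology ((\<lambda>A n. n \<in> A) ` U)"
    then show "openin powerset_topology U"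
      unfolding powerset_topology_def openin_pullback_topology
      using bij by (metis bij_is_inj inf_top.right_neutral inj_vimage_image_eq)
  qed
  show ?thesis
    using bij op
    by (intro bijective_open_imp_homeomorphic_map)
       (auto simp: bij_is_surj bij_is_inj open_map_def continuous_map_def
          inj_vimage_image_eq vimage_def[symmetric] surj_image_vimage_eq)
qed

end

(* Write J as the union of G_delta sets G m, call a set positive if it is not in J, and call T small
   for a positive Y if some F_sigma set H containing T satisfies A Int Y : J for all A in H.
   If J itself is small for Y, then {A. A Int Y : J} is an F_sigma ideal extending J. The almost-inclusion order
   on positive sets is sigma-closed, so there is a positive Y deciding, for every m and every basic
   clopen set s, whether G m Int s is small, once and for all positive subsets of Y. If some G m is
   not small for Y, let S be G m without its small basic pieces. Then near each of its points the closure of S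
   has elements with positive trace on any prescribed positive subset of Y; diagonalising again
   gives a positive Z that is almost contained in limits of S near each point of S. Interleaving
   initial segments of such limits produces A and B in G m with A Un B almost containing Z, so Z is
   in J, a contradiction. *)

theory Submission
  imports Defs
begin

section \<open>Agreement on initial segments and the topology of the power set\<close>

definition agree :: "nat \<Rightarrow> nat set \<Rightarrow> nat set \<Rightarrow> bool" where
  "agree l A B \<longleftrightarrow> (\<forall>x<l. x \<in> A \<longleftrightarrow> x \<in> B)"

lemma agree_refl [simp]: "agree l A A"
  by (simp add: agree_def)

lemma agree_sym: "agree l A B \<Longrightarrow> agree l B A"
  by (simp add: agree_def)

lemma agree_trans: "agree l A B \<Longrightarrow> agree l B C \<Longrightarrow> agree l A C"
  by (simp add: agree_def)

lemma agree_le: "agree l A B \<Longrightarrow> k \<le> l \<Longrightarrow> agree k A B"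
  by (simp add: agree_def)

text \<open>A basic box of the product restricts only finitely many coordinates, all below some
  \<open>l\<close>; conversely the sets agreeing with \<open>A\<close> below \<open>l\<close> form
  such a box.\<close>

lemma openin_powerset_topology:
  "openin powerset_topology U \<longleftrightarrow> (\<forall>A\<in>U. \<exists>l. \<forall>B. agree l A B \<longrightarrow> B \<in> U)"
proof
  assume "openin powerset_topology U"
  then obtain V where V: "openin cantor_topology V" and U: "U = (\<lambda>A n. n \<in> A) -` V"
    by (auto simp: powerset_topology_def openin_pullback_topology)
  show "\<forall>A\<in>U. \<exists>l. \<forall>B. agree l A B \<longrightarrow> B \<in> U"
  proof
    fix A assume "A \<in> U"
    then have "(\<lambda>n. n \<in> A) \<in> V"
      by (simp add: U)
    then obtain W where fin: "finite {i. W i \<noteq> (UNIV :: bool set)}"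
      and A: "(\<lambda>n. n \<in> A) \<in> Pi\<^sub>E UNIV W" and W: "Pi\<^sub>E UNIV W \<subseteq> V"
      using V unfolding cantor_topology_def openin_product_topology_alt
      by (auto dest!: bspec)
    obtain l where l: "\<And>i. W i \<noteq> UNIV \<Longrightarrow> i < l"
      using finite_nat_set_iff_bounded fin by auto
    have "B \<in> U" if "agree l A B" for B
    proof -
      have "(n \<in> B) \<in> W n" for n
      proof (cases "W n = UNIV")
        case False
        then have "n \<in> A \<longleftrightarrow> n \<in> B"
          using l that by (simp add: agree_def)
        moreover have "(n \<in> A) \<in> W n"
          using A by (rule PiE_mem) simp
        ultimately show ?thesis
          by simp
      qed simp
      then show ?thesis
        using W by (auto simp: U PiE_iff)
    qed
    then show "\<exists>l. \<forall>B. agree l A B \<longrightarrow> B \<in> U"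
      by blast
  qed
next
  assume *: "\<forall>A\<in>U. \<exists>l. \<forall>B. agree l A B \<longrightarrow> B \<in> U"
  have "openin cantor_topology {f. Collect f \<in> U}"
    unfolding cantor_topology_def openin_product_topology_alt
  proof
    fix f assume "f \<in> {f. Collect f \<in> U}"
    then obtain l where l: "\<And>B. agree l (Collect f) B \<Longrightarrow> B \<in> U"
      using * by auto
    let ?W = "\<lambda>i. if i < l then {f i} else UNIV"
    have "finite {i \<in> UNIV. ?W i \<noteq> topspace (discrete_topology UNIV)}"
      by (rule finite_subset[of _ "{..<l}"]) auto
    moreover have "Pi\<^sub>E UNIV ?W \<subseteq> {f. Collect f \<in> U}"
    proof
      fix g assume g: "g \<in> Pi\<^sub>E UNIV ?W"
      have "g i = f i" if "i < l" for i
        using PiE_mem[OF g, of i] that by simp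
      then show "g \<in> {f. Collect f \<in> U}"
        using l by (simp add: agree_def)
    qed
    ultimately show "\<exists>W. finite {i \<in> UNIV. W i \<noteq> topspace (discrete_topology UNIV)} \<and>
        (\<forall>i\<in>UNIV. openin (discrete_topology UNIV) (W i)) \<and> f \<in> Pi\<^sub>E UNIV W \<and>
        Pi\<^sub>E UNIV W \<subseteq> {f. Collect f \<in> U}"
      by (intro exI[of _ ?W]) (auto simp: PiE_iff)
  qed
  moreover have "U = (\<lambda>A n. n \<in> A) -` {f. Collect f \<in> U}"
    by auto
  ultimately show "openin powerset_topology U"
    unfolding powerset_topology_def openin_pullback_topology by blast
qed

lemma openin_agree: "openin powerset_topology {B. agree l A B}"
  unfolding openin_powerset_topology by (metis agree_trans mem_Collect_eq)

lemma in_closure_of_powerset: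
  "B \<in> powerset_topology closure_of S \<longleftrightarrow> (\<forall>l. \<exists>A\<in>S. agree l B A)"
proof
  assume B: "B \<in> powerset_topology closure_of S"
  show "\<forall>l. \<exists>A\<in>S. agree l B A"
  proof
    fix l
    show "\<exists>A\<in>S. agree l B A"
      using B openin_agree[of l B] unfolding in_closure_of
      by (metis agree_refl mem_Collect_eq)
  qed
next
  assume S: "\<forall>l. \<exists>A\<in>S. agree l B A"
  show "B \<in> powerset_topology closure_of S"
    unfolding in_closure_of
  proof (intro conjI allI impI)
    fix T assume "B \<in> T \<and> openin powerset_topology T"
    then obtain l where "\<And>A. agree l B A \<Longrightarrow> A \<in> T"
      unfolding openin_powerset_topology by blast
    then show "\<exists>y. y \<in> S \<and> y \<in> T"
      using S by blast
  qed simp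
qed

lemma continuous_map_Int:
  "continuous_map powerset_topology powerset_topology (\<lambda>A. A \<inter> Y)"
  unfolding continuous_map_def
proof (intro conjI allI impI)
  fix U assume U: "openin powerset_topology U"
  show "openin powerset_topology {A \<in> topspace powerset_topology. A \<inter> Y \<in> U}"
    unfolding openin_powerset_topology
  proof
    fix A assume "A \<in> {A \<in> topspace powerset_topology. A \<inter> Y \<in> U}"
    then obtain l where "\<And>B. agree l (A \<inter> Y) B \<Longrightarrow> B \<in> U"
      using U unfolding openin_powerset_topology by auto
    then show "\<exists>l. \<forall>B. agree l A B \<longrightarrow> B \<in> {A \<in> topspace powerset_topology. A \<inter> Y \<in> U}"
      by (intro exI[of _ l]) (auto simp: agree_def)
  qed
qed simp

lemma fsigma_in_vimage:
  assumes f: "continuous_map X Y f" and H: "fsigma_in Y H"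
  shows "fsigma_in X {x \<in> topspace X. f x \<in> H}"
proof -
  obtain T where T: "countable T" "\<And>C. C \<in> T \<Longrightarrow> closedin Y C" "\<Union>T = H"
    using H by (auto simp: fsigma_in_def union_of_def)
  have "fsigma_in X (\<Union>C\<in>T. {x \<in> topspace X. f x \<in> C})"
    using T closedin_continuous_map_preimage[OF f]
    by (intro fsigma_in_Union) (auto intro: closed_imp_fsigma_in)
  also have "(\<Union>C\<in>T. {x \<in> topspace X. f x \<in> C}) = {x \<in> topspace X. f x \<in> H}"
    using T(3) by auto
  finally show ?thesis .
qed

section \<open>Limits of finite approximations and interleaving in a G_delta set\<close>

lemma coherent_limit:
  fixes l :: "nat \<Rightarrow> nat"
  assumes "\<And>n. l n < l (Suc n)" and "\<And>n. agree (l n) (X n) (X (Suc n))"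
  obtains E where "\<And>n. agree (l n) E (X n)"
proof
  have "strict_mono l"
    by (simp add: strict_mono_Suc_iff assms(1))
  then have l: "n \<le> l n" and le: "m \<le> n \<Longrightarrow> l m \<le> l n" for m n
    by (auto simp: strict_mono_imp_increasing strict_mono_less_eq)
  have step: "agree (l m) (X m) (X n)" if "m \<le> n" for m n
    using that
  proof (induction n rule: dec_induct)
    case (step n)
    then show ?case
      using agree_trans agree_le assms(2) le by blast
  qed simp
  \<comment> \<open>Since \<open>n \<le> l n\<close>, the point \<open>x\<close> lies below
    \<open>l (Suc x)\<close>, so stage \<open>Suc x\<close> has already decided it.\<close>
  show "agree (l n) {x. x \<in> X (Suc x)} (X n)" for n
  proof -
    have "x \<in> X (Suc x) \<longleftrightarrow> x \<in> X n" if "x < l n" for x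
    proof (cases "n \<le> Suc x")
      case True
      then show ?thesis
        using step[OF True] that by (simp add: agree_def)
    next
      case False
      then show ?thesis
        using step[of "Suc x" n] l[of "Suc x"] by (simp add: agree_def)
    qed
    then show ?thesis
      by (simp add: agree_def)
  qed
qed

text \<open>Two elements of \<open>G\<close> are built simultaneously. At any time one of them follows a target
  containing \<open>Z\<close> up to finitely many points, while the other one is driven into the next open set
  of an intersection representing \<open>G\<close> and then picks its own new target; then the roles are exchanged.\<close>

lemma interleave:
  assumes G: "gdelta_in powerset_topology G" and "S \<subseteq> G" "S \<noteq> {}"
    and target: "\<And>A l. A \<in> S \<Longrightarrow>
      \<exists>B\<in>powerset_topology closure_of S. agree l A B \<and> finite (Z - B)"
  shows "\<exists>A\<in>G. \<exists>B\<in>G. finite (Z - (A \<union> B))"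
proof -
  let ?cl = "powerset_topology closure_of S"
  obtain U where U: "\<And>n. openin powerset_topology (U n)" "\<And>n. U (Suc n) \<subseteq> U n" "\<Inter>(range U) = G"
    using G unfolding gdelta_in_descending by blast
  \<comment> \<open>\<open>A\<close> is the element about to choose a new target; \<open>B\<close>
    is the current target and contains all of \<open>Z\<close> from \<open>l\<close> on.\<close>
  define st where "st A B l \<longleftrightarrow> A \<in> S \<and> B \<in> ?cl \<and> Z \<inter> {l..} \<subseteq> B" for A B and l :: nat
  have half: "\<exists>A' B' l'. l < l' \<and> st B' A' l' \<and> agree l A A' \<and> agree l B B' \<and>
      (\<forall>C. agree l' B' C \<longrightarrow> C \<in> U n) \<and> Z \<inter> {l..<l'} \<subseteq> A' \<union> B'"
    if st: "st A B l" for A B l n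
  proof -
    obtain A' where A': "A' \<in> ?cl" "agree l A A'" "finite (Z - A')"
      using target st unfolding st_def by blast
    \<comment> \<open>The new target \<open>A'\<close> is known to contain \<open>Z\<close> only
      from \<open>f\<close> on, so \<open>B'\<close> has to copy \<open>B\<close> at least up to
      \<open>f\<close> for \<open>Z\<close> to stay covered.\<close>
    obtain f where f: "\<And>x. x \<in> Z - A' \<Longrightarrow> x < f"
      using A'(3) finite_nat_set_iff_bounded by auto
    obtain B' where B': "B' \<in> S" "agree (max l f) B B'"
      using st unfolding st_def in_closure_of_powerset by blast
    have "B' \<in> U n"
      using B'(1) \<open>S \<subseteq> G\<close> U(3) by auto
    then obtain k where k: "\<And>C. agree k B' C \<Longrightarrow> C \<in> U n"
      using U(1) unfolding openin_powerset_topology by blast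
    define l' where "l' = Suc (max k (max l f))"
    have "Z \<inter> {l..<l'} \<subseteq> A' \<union> B'"
    proof
      fix x assume x: "x \<in> Z \<inter> {l..<l'}"
      then have "x \<in> B"
        using st by (auto simp: st_def)
      then show "x \<in> A' \<union> B'"
        using x f[of x] B'(2) by (auto simp: agree_def less_max_iff_disj)
    qed
    moreover have "Z \<inter> {l'..} \<subseteq> A'"
    proof
      fix x assume "x \<in> Z \<inter> {l'..}"
      then show "x \<in> A'"
        using f[of x] by (cases "x \<in> A'") (auto simp: l'_def)
    qed
    moreover have "C \<in> U n" if "agree l' B' C" for C
      using k that agree_le[of l' B' C k] by (auto simp: l'_def)
    moreover have "agree l B B'" "l < l'"
      using B'(2) agree_le[of "max l f" B B' l] by (auto simp: l'_def)
    ultimately show ?thesis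
      using A' B' unfolding st_def by blast
  qed
  \<comment> \<open>Two half steps bring both approximations into \<open>U n\<close> and restore the
    original roles.\<close>
  have full: "\<exists>A2 B2 l2. l < l2 \<and> st A2 B2 l2 \<and> agree l A A2 \<and> agree l B B2 \<and>
      (\<forall>C. agree l2 A2 C \<longrightarrow> C \<in> U n) \<and> (\<forall>C. agree l2 B2 C \<longrightarrow> C \<in> U n) \<and>
      Z \<inter> {l..<l2} \<subseteq> A2 \<union> B2"
    if st: "st A B l" for A B l n
  proof -
    obtain A1 B1 l1 where 1: "l < l1" "st B1 A1 l1" "agree l A A1" "agree l B B1"
      "\<And>C. agree l1 B1 C \<Longrightarrow> C \<in> U n" "Z \<inter> {l..<l1} \<subseteq> A1 \<union> B1"
      using half[OF st] by metis
    obtain A2 B2 l2 where 2: "l1 < l2" "st A2 B2 l2" "agree l1 A1 A2" "agree l1 B1 B2"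
      "\<And>C. agree l2 A2 C \<Longrightarrow> C \<in> U n" "Z \<inter> {l1..<l2} \<subseteq> A2 \<union> B2"
      using half[OF 1(2)] by (metis Un_commute)
    have "agree l A A2" "agree l B B2"
      using 1 2 by (auto simp: agree_def)
    moreover have "C \<in> U n" if "agree l2 B2 C" for C
      using that 1(5)[of C] 2(1,4) by (auto simp: agree_def)
    moreover have "Z \<inter> {l..<l2} \<subseteq> A2 \<union> B2"
    proof
      fix x assume x: "x \<in> Z \<inter> {l..<l2}"
      show "x \<in> A2 \<union> B2"
      proof (cases "x < l1")
        case True
        then have "x \<in> A1 \<union> B1"
          using x 1(6) by auto
        then show ?thesis
          using True 2(3,4) by (auto simp: agree_def)
      next
        case False
        then show ?thesis
          using x 2(6) by auto
      qed
    qed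
    moreover have "l < l2"
      using 1(1) 2(1) by simp
    ultimately show ?thesis
      using 2(2,5) by blast
  qed
  define P where "P x \<longleftrightarrow> st (fst x) (fst (snd x)) (snd (snd x))" for x :: "nat set \<times> nat set \<times> nat"
  define Q where "Q n x y \<longleftrightarrow> (\<exists>A B l A' B' l'. x = (A, B, l) \<and> y = (A', B', l') \<and>
      l < l' \<and> agree l A A' \<and> agree l B B' \<and>
      (\<forall>C. agree l' A' C \<longrightarrow> C \<in> U n) \<and> (\<forall>C. agree l' B' C \<longrightarrow> C \<in> U n) \<and>
      Z \<inter> {l..<l'} \<subseteq> A' \<union> B')" for n x y
  have "\<exists>f. \<forall>n. P (f n) \<and> Q n (f n) (f (Suc n))"
  proof (rule dependent_nat_choice)
    obtain A where A: "A \<in> S"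
      using \<open>S \<noteq> {}\<close> by blast
    then obtain B where B: "B \<in> ?cl" "finite (Z - B)"
      using target by blast
    then obtain l where "\<And>x. x \<in> Z - B \<Longrightarrow> x < l"
      using finite_nat_set_iff_bounded by auto
    then have "st A B l"
      using A B by (force simp: st_def)
    then show "\<exists>x. P x"
      by (auto simp: P_def)
  next
    fix x n
    assume *: "P x"
    obtain A B l where x: "x = (A, B, l)"
      by (rule prod_cases3)
    with * have "st A B l"
      by (simp add: P_def)
    then obtain A' B' l' where "l < l' \<and> st A' B' l' \<and> agree l A A' \<and> agree l B B' \<and>
        (\<forall>C. agree l' A' C \<longrightarrow> C \<in> U n) \<and> (\<forall>C. agree l' B' C \<longrightarrow> C \<in> U n) \<and>
        Z \<inter> {l..<l'} \<subseteq> A' \<union> B'"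
      using full by blast
    then have "P (A', B', l') \<and> Q n x (A', B', l')"
      by (simp add: x P_def Q_def)
    then show "\<exists>y. P y \<and> Q n x y" ..
  qed
  then obtain f where f: "\<And>n. Q n (f n) (f (Suc n))"
    by blast
  define A B l where "A n = fst (f n)" and "B n = fst (snd (f n))" and "l n = snd (snd (f n))" for n
  have "l n < l (Suc n) \<and> agree (l n) (A n) (A (Suc n)) \<and> agree (l n) (B n) (B (Suc n)) \<and>
      (\<forall>C. agree (l (Suc n)) (A (Suc n)) C \<longrightarrow> C \<in> U n) \<and>
      (\<forall>C. agree (l (Suc n)) (B (Suc n)) C \<longrightarrow> C \<in> U n) \<and>
      Z \<inter> {l n..<l (Suc n)} \<subseteq> A (Suc n) \<union> B (Suc n)" for n
    using f[of n] unfolding Q_def A_def B_def l_def by (elim exE conjE) simp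
  then have l: "l n < l (Suc n)" and A: "agree (l n) (A n) (A (Suc n))"
    and B: "agree (l n) (B n) (B (Suc n))"
    and AU: "agree (l (Suc n)) (A (Suc n)) C \<Longrightarrow> C \<in> U n"
    and BU: "agree (l (Suc n)) (B (Suc n)) C \<Longrightarrow> C \<in> U n"
    and Z: "Z \<inter> {l n..<l (Suc n)} \<subseteq> A (Suc n) \<union> B (Suc n)" for n C
    by blast+
  obtain E where E: "\<And>n. agree (l n) E (A n)"
    using coherent_limit[of l A, OF l A] by blast
  obtain F where F: "\<And>n. agree (l n) F (B n)"
    using coherent_limit[of l B, OF l B] by blast
  have "E \<in> U n" "F \<in> U n" for n
    using AU[OF agree_sym[OF E]] BU[OF agree_sym[OF F]] by blast+
  then have "E \<in> G" "F \<in> G"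
    using U(3) by blast+
  moreover have "Z - (E \<union> F) \<subseteq> {..<l 0}"
  proof
    fix x assume x: "x \<in> Z - (E \<union> F)"
    have "strict_mono l"
      by (simp add: strict_mono_Suc_iff l)
    then have "x \<le> l x"
      by (simp add: strict_mono_imp_increasing)
    \<comment> \<open>Every block between consecutive levels is covered, so an uncovered point of
      \<open>Z\<close> is pushed down to below \<open>l 0\<close>, where nothing is
      controlled.\<close>
    have "x < l n \<Longrightarrow> x < l 0" for n
    proof (induction n)
      case (Suc n)
      have "\<not> l n \<le> x"
        using Z[of n] E[of "Suc n"] F[of "Suc n"] Suc.prems x by (auto simp: agree_def)
      then show ?case
        using Suc.IH by simp
    qed
    then show "x \<in> {..<l 0}"
      using \<open>x \<le> l x\<close> l[of x] by (meson le_less_trans lessThan_iff)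
  qed
  ultimately show ?thesis
    using finite_subset by blast
qed

section \<open>Positive sets and diagonalisation modulo finite sets\<close>

lemma omega_ideal_almost_subset:
  assumes J: "omega_ideal J" and "A \<in> J" "finite (B - A)"
  shows "B \<in> J"
proof -
  have "A \<union> (B - A) \<in> J"
    using assms unfolding omega_ideal_def by blast
  moreover have "B \<subseteq> A \<union> (B - A)"
    by auto
  ultimately show ?thesis
    using J unfolding omega_ideal_def by blast
qed

lemma gdelta_sigma_in_sequence:
  assumes "gdelta_sigma_in X J"
  obtains G :: "nat \<Rightarrow> 'a set" where "\<And>n. gdelta_in X (G n)" "J = (\<Union>n. G n)"
proof -
  obtain T where T: "countable T" "T \<subseteq> Collect (gdelta_in X)" "\<Union>T = J"
    using assms by (auto simp: gdelta_sigma_in_def union_of_def)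
  \<comment> \<open>Inserting the empty set, itself a G_delta, makes the enumeration surjective even
    if \<open>T\<close> is empty.\<close>
  have "range (from_nat_into (insert {} T)) = insert {} T"
    using T by (intro range_from_nat_into) auto
  then show ?thesis
    using T by (intro that[of "from_nat_into (insert {} T)"])
      (metis (mono_tags) gdelta_in_empty insert_iff mem_Collect_eq rangeI subsetD, auto)
qed

text \<open>A Baire category argument among the sets almost contained in every \<open>X n\<close>: if no
  member of \<open>J\<close> could be avoided generically, some \<open>G m\<close> would be dense in a cube below some \<open>X k\<close>,
  so that interleaving would put \<open>X k\<close> into \<open>J\<close>.\<close>

lemma positive_pseudo_intersection:
  assumes J: "omega_ideal J" and GDS: "gdelta_sigma_in powerset_topology J"
    and pos: "\<And>n. X n \<notin> J" and decr: "\<And>n. X (Suc n) \<subseteq> X n"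
  obtains Z where "Z \<notin> J" "Z \<subseteq> X 0" "\<And>n. finite (Z - X n)"
proof -
  obtain G :: "nat \<Rightarrow> nat set set"
    where G: "\<And>n. gdelta_in powerset_topology (G n)" "J = (\<Union>n. G n)"
    using gdelta_sigma_in_sequence[OF GDS] by blast
  have anti: "X n \<subseteq> X m" if "m \<le> n" for m n
    using that by (rule lift_Suc_antimono_le[of X, OF decr])
  \<comment> \<open>A pair \<open>(k, a)\<close> acts as a forcing condition: \<open>a\<close> is
    fixed below \<open>k\<close>, and all later points are promised to lie in \<open>X k\<close>.
    \<open>N\<close> collects the sets obeying it, and \<open>ext\<close> passes to a stronger
    condition.\<close>
  define N where "N k a = {A. agree k a A \<and> A \<inter> {k..} \<subseteq> X k}" for k a
  define ext where "ext k a j b \<longleftrightarrow> k < j \<and> agree k a b \<and> b \<inter> {k..<j} \<subseteq> X k" for k a j b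
  have N_ext: "N j b \<subseteq> N k a" if e: "ext k a j b" for k a j b
  proof
    fix A assume A: "A \<in> N j b"
    have "agree k a A"
      using A e by (auto simp: N_def ext_def agree_def)
    moreover have "x \<in> X k" if x: "x \<in> A \<inter> {k..}" for x
    proof (cases "x < j")
      case True
      then have "x \<in> b"
        using A x by (auto simp: N_def agree_def)
      then show ?thesis
        using True x e by (auto simp: ext_def)
    next
      case False
      then have "x \<in> X j"
        using A x by (auto simp: N_def)
      then show ?thesis
        using anti[of k j] e by (auto simp: ext_def)
    qed
    ultimately show "A \<in> N k a"
      by (auto simp: N_def)
  qed
  have avoid: "\<exists>j b. ext k a j b \<and> N j b \<inter> G m = {}" for k a m
  proof (rule ccontr)
    assume "\<not> ?thesis"
    then have meet: "N j b \<inter> G m \<noteq> {}" if "ext k a j b" for j b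
      using that by blast
    define S where "S = G m \<inter> N k a"
    have "\<exists>A\<in>G m. \<exists>B\<in>G m. finite (X k - (A \<union> B))"
    proof (rule interleave[OF G(1)])
      show "S \<subseteq> G m"
        by (simp add: S_def)
      \<comment> \<open>Any extension yields a member of \<open>S\<close>; this one adds no
        point.\<close>
      have "ext k a (Suc k) (a \<inter> {..<k})"
        by (auto simp: ext_def agree_def)
      then show "S \<noteq> {}"
        using meet N_ext unfolding S_def by blast
    next
      fix A l assume A: "A \<in> S"
      define q where "q = max l k"
      \<comment> \<open>The target follows \<open>A\<close> and then takes in all of
        \<open>X k\<close>. Its initial segments beyond \<open>q\<close> extend
        \<open>(k, a)\<close>, so each is realised in \<open>G m\<close>, which makes
        \<open>B\<close> a limit of \<open>S\<close>.\<close>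
      define B where "B = (A \<inter> {..<q}) \<union> (X k \<inter> {q..})"
      have "\<exists>C\<in>S. agree p B C" for p
      proof -
        have "ext k a (Suc (max p q)) B"
          using A by (auto simp: ext_def S_def N_def B_def q_def agree_def)
        then obtain C where C: "C \<in> N (Suc (max p q)) B" "C \<in> S"
          using meet N_ext unfolding S_def by blast
        then have "agree p B C"
          by (auto simp: N_def intro: agree_le)
        with C show ?thesis
          by blast
      qed
      then have "B \<in> powerset_topology closure_of S"
        unfolding in_closure_of_powerset by blast
      moreover have "agree l A B"
        by (auto simp: agree_def B_def q_def)
      moreover have "finite (X k - B)"
        by (rule finite_subset[of _ "{..<q}"]) (auto simp: B_def)
      ultimately show "\<exists>B\<in>powerset_topology closure_of S. agree l A B \<and> finite (X k - B)"
        by blast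
    qed
    then obtain A B where "A \<in> J" "B \<in> J" "finite (X k - (A \<union> B))"
      using G(2) by blast
    then have "X k \<in> J"
      using J omega_ideal_almost_subset unfolding omega_ideal_def by metis
    with pos show False
      by blast
  qed
  \<comment> \<open>Starting at length 0 fixes no initial segment, which later gives
    \<open>Z \<subseteq> X 0\<close>.\<close>
  have "\<exists>f. \<forall>n. (n = 0 \<longrightarrow> fst (f n) = (0::nat)) \<and>
      (ext (fst (f n)) (snd (f n)) (fst (f (Suc n))) (snd (f (Suc n))) \<and>
       N (fst (f (Suc n))) (snd (f (Suc n))) \<inter> G n = {})"
    using avoid by (intro dependent_nat_choice) auto
  then obtain f where f: "fst (f 0) = (0::nat)"
      "\<And>n. ext (fst (f n)) (snd (f n)) (fst (f (Suc n))) (snd (f (Suc n)))"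
      "\<And>n. N (fst (f (Suc n))) (snd (f (Suc n))) \<inter> G n = {}"
    by blast
  define k a where "k n = fst (f n)" and "a n = snd (f n)" for n
  have k0: "k 0 = 0" and k: "k n < k (Suc n)" and a: "agree (k n) (a n) (a (Suc n))"
    and aX: "a (Suc n) \<inter> {k n..<k (Suc n)} \<subseteq> X (k n)"
    and NG: "N (k (Suc n)) (a (Suc n)) \<inter> G n = {}" for n
    using f(1) f(2,3)[of n] by (auto simp: k_def a_def ext_def)
  have smono: "strict_mono k"
    by (simp add: strict_mono_Suc_iff k)
  then have le_k: "n \<le> k n" for n
    by (simp add: strict_mono_imp_increasing)
  obtain Z where Z: "\<And>n. agree (k n) Z (a n)"
    using coherent_limit[of k a, OF k a] by blast
  \<comment> \<open>The block of \<open>Z\<close> from \<open>k m\<close> to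
    \<open>k (Suc m)\<close> lies in \<open>X (k m)\<close>, hence in \<open>X (k n)\<close> for
    \<open>n \<le> m\<close>; the induction finds the block containing \<open>x\<close>.\<close>
  have ZX: "Z \<inter> {k n..} \<subseteq> X (k n)" for n
  proof
    fix x assume x: "x \<in> Z \<inter> {k n..}"
    have "x < k m \<Longrightarrow> x \<in> X (k n)" for m
    proof (induction m)
      case 0
      then show ?case
        by (simp add: k0)
    next
      case (Suc m)
      show ?case
      proof (cases "x < k m")
        case False
        have "k n < k (Suc m)"
          using x Suc.prems by simp
        then have "n \<le> m"
          using smono by (simp add: strict_mono_less)
        then have "k n \<le> k m"
          using smono by (simp add: strict_mono_less_eq)
        moreover have "x \<in> a (Suc m)"
          using Z[of "Suc m"] Suc.prems x by (auto simp: agree_def)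
        ultimately show ?thesis
          using aX[of m] False Suc.prems anti by fastforce
      qed (rule Suc.IH)
    qed
    then show "x \<in> X (k n)"
      using le_k[of "Suc x"] by (meson Suc_le_lessD)
  qed
  then have "Z \<in> N (k n) (a n)" for n
    using agree_sym[OF Z] by (simp add: N_def)
  then have "Z \<notin> J"
    using NG G(2) by blast
  moreover have "Z \<subseteq> X 0"
    using ZX[of 0] by (auto simp: k0)
  moreover have "finite (Z - X n)" for n
    by (rule finite_subset[of _ "{..<k n}"]) (use ZX[of n] anti[OF le_k[of n]] in fastforce)+
  ultimately show ?thesis
    using that by blast
qed

text \<open>The requirements \<open>D i\<close> are met one after another along a decreasing
  sequence of positive sets. A positive pseudo-intersection inherits all of them because each
  survives finite changes and passing to positive subsets.\<close>

lemma positive_generic: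
  fixes D :: "'i::countable \<Rightarrow> nat set set"
  assumes J: "omega_ideal J" and GDS: "gdelta_sigma_in powerset_topology J" and X: "X \<notin> J"
    and dense: "\<And>i Y. Y \<subseteq> X \<Longrightarrow> Y \<notin> J \<Longrightarrow> \<exists>Y'\<subseteq>Y. Y' \<notin> J \<and> Y' \<in> D i"
    and closed: "\<And>i Y Z. Y \<in> D i \<Longrightarrow> Z \<notin> J \<Longrightarrow> finite (Z - Y) \<Longrightarrow> Z \<in> D i"
  obtains Z where "Z \<subseteq> X" "Z \<notin> J" "\<And>i. Z \<in> D i"
proof -
  have "\<exists>f. \<forall>n. (f n \<subseteq> X \<and> f n \<notin> J) \<and> (f (Suc n) \<subseteq> f n \<and> f (Suc n) \<in> D (from_nat n))"
  proof (rule dependent_nat_choice)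
    show "\<exists>Y. Y \<subseteq> X \<and> Y \<notin> J"
      using X by blast
  next
    fix Y n assume "Y \<subseteq> X \<and> Y \<notin> J"
    then show "\<exists>Y'. (Y' \<subseteq> X \<and> Y' \<notin> J) \<and> (Y' \<subseteq> Y \<and> Y' \<in> D (from_nat n))"
      using dense[of Y "from_nat n"] by blast
  qed
  then obtain f where f: "\<And>n. f n \<subseteq> X" "\<And>n. f n \<notin> J" "\<And>n. f (Suc n) \<subseteq> f n"
      "\<And>n. f (Suc n) \<in> D (from_nat n)"
    by blast
  obtain Z where Z: "Z \<notin> J" "Z \<subseteq> f 0" "\<And>n. finite (Z - f n)"
    using positive_pseudo_intersection[of J f, OF J GDS f(2,3)] by blast
  have "Z \<in> D i" for i
    using closed[OF f(4)[of "to_nat i"] Z(1,3)] by simp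
  then show ?thesis
    using that Z f(1) by blast
qed

section \<open>Small families and the trace ideal\<close>

definition small :: "nat set set \<Rightarrow> nat set \<Rightarrow> nat set set \<Rightarrow> bool" where
  "small J Y S \<longleftrightarrow> (\<exists>H. fsigma_in powerset_topology H \<and> S \<subseteq> H \<and> (\<forall>A\<in>H. A \<inter> Y \<in> J))"

lemma small_subset: "small J Y S \<Longrightarrow> T \<subseteq> S \<Longrightarrow> small J Y T"
  unfolding small_def by blast

text \<open>Smallness is witnessed by F_sigma rather than closed sets so that countable unions of
  witnesses are again witnesses.\<close>

lemma small_Union:
  assumes "countable I" and "\<And>i. i \<in> I \<Longrightarrow> small J Y (S i)"
  shows "small J Y (\<Union>i\<in>I. S i)"
proof -
  obtain H where H: "\<And>i. i \<in> I \<Longrightarrow> fsigma_in powerset_topology (H i) \<and> S i \<subseteq> H i \<and> (\<forall>A\<in>H i. A \<inter> Y \<in> J)"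
    using assms(2) unfolding small_def by metis
  have "fsigma_in powerset_topology (\<Union>i\<in>I. H i)"
    using assms(1) H by (intro fsigma_in_Union) auto
  then show ?thesis
    unfolding small_def using H by (intro exI[of _ "\<Union>i\<in>I. H i"]) blast
qed

text \<open>The same witness serves, as \<open>A \<inter> Z\<close> exceeds
  \<open>A \<inter> Y\<close> by finitely many points only.\<close>

lemma small_almost_subset:
  assumes J: "omega_ideal J" and "small J Y S" and "finite (Z - Y)"
  shows "small J Z S"
proof -
  have "A \<inter> Z \<in> J" if "A \<inter> Y \<in> J" for A
    using J that
  proof (rule omega_ideal_almost_subset)
    show "finite (A \<inter> Z - A \<inter> Y)"
      using assms(3) by (rule rev_finite_subset) blast
  qed
  then show ?thesis
    using assms(2) unfolding small_def by blast
qed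

text \<open>For a witness \<open>H\<close>, a trace \<open>A \<inter> Y\<close> lies in
  \<open>J\<close> exactly when it lies in \<open>H\<close>, since intersecting it with
  \<open>Y\<close> again changes nothing. The trace ideal is thus the preimage of an F_sigma set
  under a continuous map.\<close>

lemma fsigma_extension_if_small:
  assumes J: "omega_ideal J" and "Y \<notin> J" and "small J Y J"
  shows "\<exists>J'. omega_ideal J' \<and> fsigma_in powerset_topology J' \<and> J \<subseteq> J'"
proof (intro exI conjI)
  let ?J' = "{A. A \<inter> Y \<in> J}"
  have down: "B \<in> J" if "A \<in> J" "B \<subseteq> A" for A B
    using J that unfolding omega_ideal_def by blast
  show "omega_ideal ?J'"
    unfolding omega_ideal_def
  proof (intro conjI ballI allI impI)
    show "A \<union> B \<in> ?J'" if "A \<in> ?J'" "B \<in> ?J'" for A B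
      using J that by (simp add: Int_Un_distrib2 omega_ideal_def)
    show "B \<in> ?J'" if "A \<in> ?J'" "B \<subseteq> A" for A B
      using that down[of "A \<inter> Y" "B \<inter> Y"] by blast
    show "A \<in> ?J'" if "finite A" for A
      using J that by (simp add: omega_ideal_def)
    show "UNIV \<notin> ?J'"
      using \<open>Y \<notin> J\<close> by simp
  qed
  obtain H where H: "fsigma_in powerset_topology H" "J \<subseteq> H" "\<And>A. A \<in> H \<Longrightarrow> A \<inter> Y \<in> J"
    using \<open>small J Y J\<close> unfolding small_def by blast
  have "A \<inter> Y \<in> J \<longleftrightarrow> A \<inter> Y \<in> H" for A
    using H(2) H(3)[of "A \<inter> Y"] by auto
  then show "fsigma_in powerset_topology ?J'"
    using fsigma_in_vimage[OF continuous_map_Int H(1), of Y] by simp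
  show "J \<subseteq> ?J'"
    using down by blast
qed

section \<open>A positive set for which the whole ideal is small\<close>

text \<open>Indexing the basic clopen sets by a number and a finite list gives a countable index
  type, as required for diagonalising over them and for taking unions of small pieces.\<close>

abbreviation cylinder :: "nat \<times> nat list \<Rightarrow> nat set set" where
  "cylinder s \<equiv> {A. agree (fst s) (set (snd s)) A}"

lemma cylinder_of: "\<exists>s. fst s = l \<and> A \<in> cylinder s"
proof -
  have "finite (A \<inter> {..<l})"
    by simp
  then obtain xs where "set xs = A \<inter> {..<l}"
    using finite_list by blast
  then show ?thesis
    by (intro exI[of _ "(l, xs)"]) (simp add: agree_def)
qed

lemma positive_small:
  assumes J: "omega_ideal J" and GDS: "gdelta_sigma_in powerset_topology J"
  shows "\<exists>Y. Y \<notin> J \<and> small J Y J"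
proof (rule ccontr)
  assume none: "\<not> ?thesis"
  obtain G :: "nat \<Rightarrow> nat set set"
    where G: "\<And>n. gdelta_in powerset_topology (G n)" "J = (\<Union>n. G n)"
    using gdelta_sigma_in_sequence[OF GDS] by blast
  have down: "B \<in> J" if "A \<in> J" "B \<subseteq> A" for A B
    using J that unfolding omega_ideal_def by blast
  define D where "D i = {Y. small J Y (G (fst i) \<inter> cylinder (snd i)) \<or>
      (\<forall>Y'\<subseteq>Y. Y' \<notin> J \<longrightarrow> \<not> small J Y' (G (fst i) \<inter> cylinder (snd i)))}" for i
  obtain Y where Y: "Y \<notin> J" "\<And>i. Y \<in> D i"
  proof (rule positive_generic[of J UNIV D, OF J GDS])
    show "UNIV \<notin> J"
      using J by (simp add: omega_ideal_def)
    show "\<exists>Y'\<subseteq>Y. Y' \<notin> J \<and> Y' \<in> D i" if "Y \<notin> J" for i Y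
      using that unfolding D_def by blast
    show "Z \<in> D i" if Y: "Y \<in> D i" and fin: "finite (Z - Y)" for i Y Z
    proof (cases "small J Y (G (fst i) \<inter> cylinder (snd i))")
      case True
      then show ?thesis
        using small_almost_subset[OF J] fin by (simp add: D_def)
    next
      case False
      have "\<not> small J Z' (G (fst i) \<inter> cylinder (snd i))" if Z': "Z' \<subseteq> Z" "Z' \<notin> J" for Z'
      proof
        \<comment> \<open>\<open>Z' \<inter> Y\<close> is a positive subset of \<open>Y\<close> that
          would inherit smallness from \<open>Z'\<close>, against the decision made by
          \<open>Y\<close>.\<close>
        have "finite (Z' - Z' \<inter> Y)"
          by (rule finite_subset[OF _ fin]) (use Z'(1) in blast)
        then have "Z' \<inter> Y \<notin> J"
          using omega_ideal_almost_subset[OF J] Z'(2) by blast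
        moreover assume "small J Z' (G (fst i) \<inter> cylinder (snd i))"
        then have "small J (Z' \<inter> Y) (G (fst i) \<inter> cylinder (snd i))"
          by (rule small_almost_subset[OF J]) (simp add: Diff_eq_empty_iff[THEN iffD2])
        ultimately show False
          using Y False unfolding D_def by blast
      qed
      then show ?thesis
        unfolding D_def by blast
    qed
  qed blast
  obtain m where m: "\<not> small J Y (G m)"
    using none Y(1) small_Union[of UNIV J Y G] G(2) by auto
  define I where "I = {s. small J Y (G m \<inter> cylinder s)}"
  define S where "S = G m - (\<Union>s\<in>I. cylinder s)"
  have "small J Y (\<Union>s\<in>I. G m \<inter> cylinder s)"
    by (rule small_Union) (auto simp: I_def)
  then have rest: "small J Y' (\<Union>s\<in>I. G m \<inter> cylinder s)" if "Y' \<subseteq> Y" for Y'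
    using small_almost_subset[OF J] that by (metis Diff_eq_empty_iff finite.emptyI)
  \<comment> \<open>\<open>G m\<close> differs from \<open>S\<close> only by countably many small
    pieces, so smallness of \<open>S\<close> in a cylinder would pass to \<open>G m\<close> there.
    As \<open>Y\<close> has decided this case, the cylinder would have been removed from
    \<open>S\<close>.\<close>
  have big: "\<not> small J Y' (S \<inter> cylinder s)"
    if "S \<inter> cylinder s \<noteq> {}" and Y': "Y' \<subseteq> Y" "Y' \<notin> J" for Y' s
  proof
    assume sm: "small J Y' (S \<inter> cylinder s)"
    have "small J Y' (\<Union>b. if b then S \<inter> cylinder s else \<Union>s\<in>I. G m \<inter> cylinder s)"
      by (rule small_Union) (use sm rest[OF Y'(1)] in auto)
    then have "small J Y' (G m \<inter> cylinder s)"
      by (rule small_subset) (auto simp: S_def)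
    then have "s \<in> I"
      using Y(2)[of "(m, s)"] Y' by (auto simp: D_def I_def)
    then show False
      using that(1) by (auto simp: S_def)
  qed
  define E where "E s = {Z. S \<inter> cylinder s \<noteq> {} \<longrightarrow>
      (\<exists>B\<in>powerset_topology closure_of (S \<inter> cylinder s). finite (Z - B))}" for s
  obtain Z where Z: "Z \<notin> J" "\<And>s. Z \<in> E s"
  proof (rule positive_generic[of J Y E, OF J GDS Y(1)])
    show "\<exists>Z\<subseteq>Y'. Z \<notin> J \<and> Z \<in> E s" if Y': "Y' \<subseteq> Y" "Y' \<notin> J" for s Y'
    proof (cases "S \<inter> cylinder s = {}")
      case True
      then show ?thesis
        using Y' by (auto simp: E_def)
    next
      case False
      \<comment> \<open>The closure is itself an F_sigma set containing the piece, so by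
        \<open>big\<close> it cannot witness smallness: some limit \<open>B\<close> has a positive
        trace on \<open>Y'\<close>, and that trace is the required subset.\<close>
      let ?C = "powerset_topology closure_of (S \<inter> cylinder s)"
      have "fsigma_in powerset_topology ?C" "S \<inter> cylinder s \<subseteq> ?C"
        by (auto intro!: closed_imp_fsigma_in closure_of_subset)
      then obtain B where B: "B \<in> ?C" "B \<inter> Y' \<notin> J"
        using big[OF False Y'] unfolding small_def by blast
      have "finite (B \<inter> Y' - B)"
        by (simp add: Diff_eq_empty_iff[THEN iffD2])
      then have "B \<inter> Y' \<in> E s"
        using B(1) unfolding E_def by blast
      with B(2) show ?thesis
        by blast
    qed
    show "Z \<in> E s" if "Y' \<in> E s" "finite (Z - Y')" for s Y' Z
    proof -
      have "finite (Z - B)" if "finite (Y' - B)" for B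
        using finite_UnI[OF that \<open>finite (Z - Y')\<close>] by (rule rev_finite_subset) blast
      then show ?thesis
        using that(1) unfolding E_def by blast
    qed
  qed blast
  have "\<exists>A\<in>G m. \<exists>B\<in>G m. finite (Z - (A \<union> B))"
  proof (rule interleave[OF G(1)])
    show "S \<subseteq> G m"
      by (auto simp: S_def)
    show "S \<noteq> {}"
    proof
      assume "S = {}"
      then have "G m \<subseteq> (\<Union>s\<in>I. G m \<inter> cylinder s)"
        by (auto simp: S_def)
      then show False
        using m small_subset rest by blast
    qed
  next
    fix A l assume A: "A \<in> S"
    \<comment> \<open>A cylinder of length exactly \<open>l\<close> around \<open>A\<close> forces
      every limit of \<open>S\<close> inside it to agree with \<open>A\<close> below
      \<open>l\<close>.\<close>
    obtain s where s: "fst s = l" "A \<in> cylinder s"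
      using cylinder_of by blast
    then obtain B where B: "B \<in> powerset_topology closure_of (S \<inter> cylinder s)" "finite (Z - B)"
      using Z(2)[of s] A unfolding E_def by blast
    have "B \<in> powerset_topology closure_of S"
      using B(1) closure_of_mono[of "S \<inter> cylinder s" S] by blast
    moreover obtain C where "C \<in> cylinder s" "agree l B C"
      using B(1) unfolding in_closure_of_powerset by blast
    then have "agree l A B"
      using s by (auto simp: agree_def)
    ultimately show "\<exists>B\<in>powerset_topology closure_of S. agree l A B \<and> finite (Z - B)"
      using B(2) by blast
  qed
  then obtain A B where "A \<in> J" "B \<in> J" "finite (Z - (A \<union> B))"
    using G(2) by blast
  then have "Z \<in> J"
    using J omega_ideal_almost_subset unfolding omega_ideal_def by metis
  with Z(1) show False
    by blast
qed

theorem proposition10p1: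
  fixes J :: "nat set set"
  assumes "omega_ideal J"
    and "gdelta_sigma_in powerset_topology J"
  shows "\<exists>J'. omega_ideal J' \<and> fsigma_in powerset_topology J' \<and> J \<subseteq> J'"
  using positive_small[OF assms] fsigma_extension_if_small[OF assms(1)] by blast

end
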